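(* Let $\mathcal{C}\subset\mathbb{N}^p$ be a finitely generated integer cone with extremal rays $\tau_1,\ldots,\tau_q$, and let $S\subset\mathbb{N}^p$ be a $\mathcal{C}$-semigroup. Let $\Lambda'=\{\mathbf{s}_{t_1},\ldots,\mathbf{s}_{t_k}\}$ be the set of minimal generators of $S$ lying in $\mathcal{A}$ (so $k=\sharp\Lambda'$), and for $l\in[k]$ let $M_l=\{i\in[q]\mid \Upsilon_i(\mathbf{s}_{t_l})\in\Gamma_i\cup\{0\}\}$. Then $$\mathrm{e}(S)\ge\sum_{i\in[q]}\big(\mathrm{e}(S_i)+\mathrm{e}(T_i)\big)+k-\sum_{l\in[k]}\sharp(M_l).$$
   Context: $\mathbb{N}$ is the set of non-negative integers and $[n]=\{1,\ldots,n\}$; $\sharp$ denotes cardinality. An affine semigroup is a finitely generated submonoid of $\mathbb{N}^p$ (it contains $0$). The embedding dimension $\mathrm{e}(\cdot)$ of such a monoid is the cardinality of its minimal generating set; $\Lambda_S$ denotes the minimal generating set of $S$. A finitely generated integer cone $\mathcal{C}\subset\mathbb{N}^p$ is $\mathcal{C}=L\cap\mathbb{N}^p$, where $L\subset\mathbb{R}^p_{\ge}$ is a polyhedral real cone with a rational point in each extremal ray. An affine semigroup $S\subset\mathcal{C}$ is a $\mathcal{C}$-semigroup if $\mathcal{C}\setminus S$ is finite. Let $h_1(x)=0,\ldots,h_t(x)=0$ be the supported hyperplanes of $L$ (those defining its facets), where each $h_j$ is a linear form with relatively prime integer coefficients and $L=\{x\in\mathbb{R}^p_{\ge}\mid h_1(x)\ge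 0,\ldots,h_t(x)\ge 0\}$. Let $\tau_1,\ldots,\tau_q$ be the extremal rays of $L$. For $i\in[q]$, let $J_i=\{j_1<\cdots<j_{p-1}\}\subset[t]$ be the index set of the supported hyperplanes containing $\tau_i$; it is assumed to have $p-1$ elements and the equations $h_j(x)=0$, $j\in J_i$, determine $\tau_i$ (their common solution set is the line spanned by $\tau_i$). Let $\mathbf{a}_i$ be the minimal non-zero non-negative integer vector with $\tau_i=\{\lambda\mathbf{a}_i\mid\lambda\in\mathbb{R}_{\ge}\}$. For $P\in\mathcal{C}$, $\Upsilon_i(P)=(h_{j_1}(P),\ldots,h_{j_{p-1}}(P))\in\mathbb{N}^{p-1}$. Let $\mathcal{A}=\{\sum_{i\in[q]}\lambda_i\mathbf{a}_i\mid 0\le\lambda_i\le 1\}\cap\mathbb{N}^p$. For $i\in[q]$, $T_i\subset\mathbb{N}^{p-1}$ is the monoid generated by $\{\Upsilon_i(Q)\mid Q\in\mathcal{A}\}$, $\Gamma_i$ is its minimal generating set, and $S_i=\{\lambda\in\mathbb{N}\mid\lambda\mathbf{a}_i\in S\}$, which is a numerical semigroup. *)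

theory Defs
  imports "HOL-Analysis.Analysis" "HOL-Library.Function_Algebras"
begin

text \<open>
  \<open>\<nat>\<^sup>p\<close> is \<^typ>\<open>nat ^ 'p\<close> and \<open>\<real>\<^sup>p\<close> is \<^typ>\<open>real ^ 'p\<close>, with \<open>p = CARD('p)\<close>.
  Vectors in \<open>\<nat>\<^sup>p\<^sup>-\<^sup>1\<close> are functions \<^typ>\<open>nat \<Rightarrow> nat\<close> that vanish outside \<open>{..<p - 1}\<close>, added pointwise.
\<close>

subsection \<open>Monoids and minimal generating sets\<close>

definition add_submonoid :: "'a::comm_monoid_add set \<Rightarrow> bool" where
  "add_submonoid M \<longleftrightarrow> 0 \<in> M \<and> (\<forall>x\<in>M. \<forall>y\<in>M. x + y \<in> M)"

text \<open>The monoid generated by \<open>G\<close> is \<^term>\<open>add_submonoid hull G\<close>.\<close>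

definition is_min_gen_set :: "'a::comm_monoid_add set \<Rightarrow> 'a set \<Rightarrow> bool" where
  "is_min_gen_set G M \<longleftrightarrow>
     add_submonoid hull G = M \<and> (\<forall>G'. G' \<subset> G \<longrightarrow> add_submonoid hull G' \<noteq> M)"

text \<open>Submonoids of \<open>\<nat>\<^sup>n\<close> have exactly one minimal generating set, so the description below is proper.\<close>

definition min_gens :: "'a::comm_monoid_add set \<Rightarrow> 'a set" where
  "min_gens M = (THE G. is_min_gen_set G M)"

definition emb_dim :: "'a::comm_monoid_add set \<Rightarrow> nat" where
  "emb_dim M = card (min_gens M)"

definition affine_semigroup :: "(nat ^ 'p::finite) set \<Rightarrow> bool" where
  "affine_semigroup S \<longleftrightarrow> (\<exists>G. finite G \<and> add_submonoid hull G = S)"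

definition C_semigroup :: "(nat ^ 'p::finite) set \<Rightarrow> (nat ^ 'p) set \<Rightarrow> bool" where
  "C_semigroup C S \<longleftrightarrow> affine_semigroup S \<and> S \<subseteq> C \<and> finite (C - S)"

subsection \<open>Integer cones\<close>

definition of_nat_vec :: "nat ^ 'p::finite \<Rightarrow> 'a::semiring_1 ^ 'p" where
  "of_nat_vec x = (\<chi> k. of_nat (x $ k))"

text \<open>The extremal rays of \<open>L\<close> are its one-dimensional faces, \<^term>\<open>R edge_of L\<close>.\<close>

definition rational_polyhedral_cone :: "(real ^ 'p::finite) set \<Rightarrow> bool" where
  "rational_polyhedral_cone L \<longleftrightarrow>
     polyhedron L \<and> convex_cone L \<and> L \<subseteq> {x. \<forall>k. 0 \<le> x $ k} \<and>
     (\<forall>R. R edge_of L \<longrightarrow> (\<exists>x\<in>R. x \<noteq> 0 \<and> (\<forall>k. x $ k \<in> \<rat>)))"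

definition int_cone :: "(real ^ 'p::finite) set \<Rightarrow> (nat ^ 'p) set" where
  "int_cone L = {P. of_nat_vec P \<in> L}"

subsection \<open>Supported hyperplanes and extremal rays\<close>

definition lin_form :: "int ^ 'p::finite \<Rightarrow> 'a::comm_ring_1 ^ 'p \<Rightarrow> 'a" where
  "lin_form c x = (\<Sum>k\<in>UNIV. of_int (c $ k) * x $ k)"

text \<open>
  The vector \<open>c j\<close> holds the coefficients of the form \<open>h\<^sub>j\<close>, for \<open>j \<in> {1..t}\<close>.
  Injectivity of \<open>c\<close> says that the hyperplanes are listed without repetition: the coefficients are
  relatively prime, and \<open>h\<^sub>j\<close> and \<open>- h\<^sub>j\<close> are not both non-negative on \<open>L\<close> when \<open>h\<^sub>j = 0\<close> cuts out a facet.
\<close>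

definition supported_hyperplanes ::
    "(real ^ 'p::finite) set \<Rightarrow> nat \<Rightarrow> (nat \<Rightarrow> int ^ 'p) \<Rightarrow> bool" where
  "supported_hyperplanes L t c \<longleftrightarrow>
     inj_on c {1..t} \<and>
     (\<forall>j\<in>{1..t}. Gcd (range (\<lambda>k. c j $ k)) = 1) \<and>
     (\<lambda>j. {x \<in> L. lin_form (c j) x = 0}) ` {1..t} = {F. F facet_of L} \<and>
     L = {x. (\<forall>k. 0 \<le> x $ k) \<and> (\<forall>j\<in>{1..t}. 0 \<le> lin_form (c j) x)}"

definition hyperplanes_through ::
    "nat \<Rightarrow> (nat \<Rightarrow> int ^ 'p::finite) \<Rightarrow> (real ^ 'p) set \<Rightarrow> nat set" where
  "hyperplanes_through t c R = {j \<in> {1..t}. \<forall>x\<in>R. lin_form (c j) x = 0}"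

definition ray_determined ::
    "nat \<Rightarrow> (nat \<Rightarrow> int ^ 'p::finite) \<Rightarrow> (real ^ 'p) set \<Rightarrow> bool" where
  "ray_determined t c R \<longleftrightarrow>
     card (hyperplanes_through t c R) = CARD('p) - 1 \<and>
     {x. \<forall>j\<in>hyperplanes_through t c R. lin_form (c j) x = 0} = span R"

text \<open>
  \<^term>\<open>(\<le>)\<close> on \<^typ>\<open>nat ^ 'p\<close> is componentwise. The integer vectors spanning a ray
  are the positive multiples of one of them, so there is a least one.
\<close>

definition ray_gen :: "(real ^ 'p::finite) set \<Rightarrow> nat ^ 'p" where
  "ray_gen R = (LEAST a. a \<noteq> 0 \<and> R = {l *\<^sub>R of_nat_vec a | l. 0 \<le> l})"

text \<open>
  Coordinate \<open>m < p - 1\<close> (counted from 0) is the value at \<open>P\<close> of the form whose index is the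
  \<open>(m + 1)\<close>-st smallest one in \<^term>\<open>hyperplanes_through t c R\<close>. The
  forms are non-negative on \<^term>\<open>int_cone L\<close>, where \<^term>\<open>nat\<close> therefore does not truncate.
\<close>

definition Upsilon ::
    "nat \<Rightarrow> (nat \<Rightarrow> int ^ 'p::finite) \<Rightarrow> (real ^ 'p) set \<Rightarrow> nat ^ 'p \<Rightarrow> (nat \<Rightarrow> nat)" where
  "Upsilon t c R P =
     (\<lambda>m. if m < CARD('p) - 1
          then nat (lin_form (c (sorted_list_of_set (hyperplanes_through t c R) ! m)) (of_nat_vec P))
          else 0)"

subsection \<open>The monoids attached to the extremal rays\<close>

text \<open>The rays are \<open>\<tau> i\<close> for \<open>i \<in> {1..q}\<close>.\<close>

definition ray_zonotope :: "nat \<Rightarrow> (nat \<Rightarrow> (real ^ 'p::finite) set) \<Rightarrow> (nat ^ 'p) set" where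
  "ray_zonotope q \<tau> =
     {P. \<exists>l. (\<forall>i\<in>{1..q}. 0 \<le> l i \<and> l i \<le> 1) \<and>
             of_nat_vec P = (\<Sum>i\<in>{1..q}. l i *\<^sub>R (of_nat_vec (ray_gen (\<tau> i)) :: real ^ 'p))}"

definition T_monoid ::
    "nat \<Rightarrow> (nat \<Rightarrow> int ^ 'p::finite) \<Rightarrow> nat \<Rightarrow> (nat \<Rightarrow> (real ^ 'p) set) \<Rightarrow> nat \<Rightarrow> (nat \<Rightarrow> nat) set" where
  "T_monoid t c q \<tau> i = add_submonoid hull (Upsilon t c (\<tau> i) ` ray_zonotope q \<tau>)"

definition S_ray :: "(nat ^ 'p::finite) set \<Rightarrow> (real ^ 'p) set \<Rightarrow> nat set" where
  "S_ray S R = {l. l *s ray_gen R \<in> S}"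

text \<open>The set of rays \<open>M\<^sub>l\<close> belonging to the minimal generator \<open>s\<close> of \<open>S\<close>.\<close>

definition M_set ::
    "nat \<Rightarrow> (nat \<Rightarrow> int ^ 'p::finite) \<Rightarrow> nat \<Rightarrow> (nat \<Rightarrow> (real ^ 'p) set) \<Rightarrow> nat ^ 'p \<Rightarrow> nat set" where
  "M_set t c q \<tau> s =
     {i \<in> {1..q}. Upsilon t c (\<tau> i) s \<in> min_gens (T_monoid t c q \<tau> i) \<union> {0}}"

end

theory Submission
  imports Defs
begin

text \<open>
  Fix an extremal ray \<open>\<tau> i\<close> with primitive vector \<open>a i\<close>. The map \<open>\<Upsilon> i\<close> is additive on the integer cone
  and vanishes exactly on the points of \<open>\<tau> i\<close>, so a point of the ray only decomposes into points of the
  ray: if \<open>n\<close> is a minimal generator of \<open>S_ray S (\<tau> i)\<close>, then \<open>n a i\<close> is one of \<open>S\<close>, with \<open>\<Upsilon> i\<close>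
  equal to 0 (\<open>multiple_irreducible\<close>). Every point of the cone is a sum of points of the zonotope, so \<open>\<Upsilon> i\<close>
  maps the cone into \<open>T i\<close>. As \<open>S\<close> misses only finitely many points of the cone, \<open>\<Upsilon> i\<close> reaches each minimal
  generator of \<open>T i\<close> on \<open>S\<close>, and a decomposition in \<open>S\<close> of a preimage has exactly one summand with
  non-zero value; so \<open>\<Upsilon> i\<close> reaches it on a minimal generator of \<open>S\<close> (\<open>irreducible_over_T_generator\<close>).

  Call a minimal generator \<open>s\<close> of \<open>S\<close> incident with the ray \<open>i\<close> if \<open>\<Upsilon> i s\<close> is 0 or a minimal generator
  of \<open>T i\<close>, that is, if \<open>i\<close> is in the set \<open>M\<close> of \<open>s\<close>. The ray \<open>i\<close> then has at least
  \<open>e(S_ray S (\<tau> i)) + e(T i)\<close> incidences. Counted from the other side, a generator in the zonotope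
  contributes the cardinality of its set \<open>M\<close>. A generator \<open>s\<close> outside of the zonotope contributes at most 1
  (\<open>card_M_set_outside_zonotope\<close>): for some \<open>i\<close> the difference \<open>s - a i\<close> is still in the cone, and
  \<open>\<Upsilon> l s = \<Upsilon> l (a i) + \<Upsilon> l (s - a i)\<close> has two non-zero summands for all \<open>l\<close> other than \<open>i\<close>, unless
  \<open>s - a i\<close> lies on a second ray, in which case a variant of the splitting leaves only that ray. There are
  \<open>e(S) - k\<close> generators outside of the zonotope, and the inequality follows.

  Convex geometry enters through the fact that the cone is spanned by its extremal rays
  (\<open>cone_eq_sum_of_extremal_rays\<close>), a consequence of the Krein-Milman-Minkowski theorem.
\<close>

section \<open>Minimal generating sets of graded monoids\<close>

definition irreducibles :: "'a::comm_monoid_add set \<Rightarrow> 'a set" where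
  "irreducibles M = {x \<in> M. x \<noteq> 0 \<and> (\<forall>y\<in>M. \<forall>z\<in>M. x = y + z \<longrightarrow> y = 0 \<or> z = 0)}"

lemma irreduciblesD:
  assumes "x \<in> irreducibles M"
  shows "x \<in> M" "x \<noteq> 0" "y \<in> M \<Longrightarrow> z \<in> M \<Longrightarrow> x = y + z \<Longrightarrow> y = 0 \<or> z = 0"
  using assms by (auto simp: irreducibles_def)

lemma reducibleE:
  assumes "x \<in> M" "x \<noteq> 0" "x \<notin> irreducibles M"
  obtains y z where "y \<in> M" "z \<in> M" "x = y + z" "y \<noteq> 0" "z \<noteq> 0"
  using assms by (auto simp: irreducibles_def)

lemma add_submonoid_hull: "add_submonoid (add_submonoid hull G)"
  by (auto simp: add_submonoid_def hull_def)

text \<open>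
  Removing from the generated monoid all irreducible elements outside of \<open>G\<close> leaves a submonoid,
  because a sum can only be irreducible if one of its summands is zero.
\<close>

lemma irreducibles_hull_subset: "irreducibles (add_submonoid hull G) \<subseteq> G"
proof -
  let ?M = "add_submonoid hull G"
  let ?N = "{x \<in> ?M. x \<in> irreducibles ?M \<longrightarrow> x \<in> G}"
  have M: "0 \<in> ?M" "\<And>x y. x \<in> ?M \<Longrightarrow> y \<in> ?M \<Longrightarrow> x + y \<in> ?M"
    using add_submonoid_hull[of G] by (auto simp: add_submonoid_def)
  have "x + y \<in> ?N" if "x \<in> ?N" "y \<in> ?N" for x y
  proof (cases "x + y \<in> irreducibles ?M")
    case True
    then have "x = 0 \<or> y = 0"
      using that irreduciblesD(3)[OF True] by auto
    then show ?thesis using that by auto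
  next
    case False
    then show ?thesis using that M by auto
  qed
  then have "add_submonoid ?N"
    using M(1) irreduciblesD(2) by (auto simp: add_submonoid_def)
  moreover have "G \<subseteq> ?N"
    by (auto intro: hull_inc)
  ultimately have "?M \<subseteq> ?N"
    by (intro hull_minimal)
  then show ?thesis
    using irreduciblesD(1) by blast
qed

text \<open>
  The three kinds of monoids considered below all carry such a degree, which makes them pointed and
  allows inductions along decompositions.
\<close>

definition graded_by :: "('a::comm_monoid_add \<Rightarrow> nat) \<Rightarrow> 'a set \<Rightarrow> bool" where
  "graded_by \<phi> M \<longleftrightarrow> (\<forall>x\<in>M. \<forall>y\<in>M. \<phi> (x + y) = \<phi> x + \<phi> y) \<and> (\<forall>x\<in>M. \<phi> x = 0 \<longrightarrow> x = 0)"

lemma graded_by_summands_less: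
  assumes "graded_by \<phi> M" "y \<in> M" "z \<in> M" "y \<noteq> 0" "z \<noteq> 0"
  shows "\<phi> y < \<phi> (y + z)" "\<phi> z < \<phi> (y + z)"
proof -
  have "\<phi> (y + z) = \<phi> y + \<phi> z" "\<phi> y \<noteq> 0" "\<phi> z \<noteq> 0"
    using assms unfolding graded_by_def by blast+
  then show "\<phi> y < \<phi> (y + z)" "\<phi> z < \<phi> (y + z)"
    by simp_all
qed

lemma hull_irreducibles:
  assumes M: "add_submonoid M" and gr: "graded_by \<phi> M"
  shows "add_submonoid hull (irreducibles M) = M"
proof
  show "add_submonoid hull (irreducibles M) \<subseteq> M"
    using M irreduciblesD(1) by (intro hull_minimal) auto
  let ?H = "add_submonoid hull (irreducibles M)"
  have H: "0 \<in> ?H" "\<And>x y. x \<in> ?H \<Longrightarrow> y \<in> ?H \<Longrightarrow> x + y \<in> ?H"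
    using add_submonoid_hull[of "irreducibles M"] by (auto simp: add_submonoid_def)
  have "x \<in> M \<longrightarrow> x \<in> ?H" for x
  proof (induction "\<phi> x" arbitrary: x rule: less_induct)
    case less
    show ?case
    proof (intro impI)
      assume x: "x \<in> M"
      consider "x = 0" | "x \<in> irreducibles M" | "x \<noteq> 0" "x \<notin> irreducibles M"
        by blast
      then show "x \<in> ?H"
      proof cases
        case 1
        then show ?thesis using H(1) by simp
      next
        case 2
        then show ?thesis by (rule hull_inc)
      next
        case 3
        then obtain y z where yz: "y \<in> M" "z \<in> M" "x = y + z" "y \<noteq> 0" "z \<noteq> 0"
          using reducibleE[OF x 3] by blast
        then have "\<phi> y < \<phi> x" "\<phi> z < \<phi> x"
          using graded_by_summands_less[OF gr] by auto
        then show ?thesis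
          using less yz H(2) by auto
      qed
    qed
  qed
  then show "M \<subseteq> ?H" by blast
qed

text \<open>
  The irreducible elements generate by induction on the grading and lie in every generating set;
  hence they form the only minimal one.
\<close>

lemma min_gens_eq_irreducibles:
  assumes M: "add_submonoid M" and gr: "graded_by \<phi> M"
  shows "min_gens M = irreducibles M"
  unfolding min_gens_def
proof (rule the_equality)
  have sub: "irreducibles M \<subseteq> G" if "add_submonoid hull G = M" for G
    using irreducibles_hull_subset that by blast
  show "is_min_gen_set (irreducibles M) M"
    using hull_irreducibles[OF M gr] sub by (auto simp: is_min_gen_set_def)
  show "G = irreducibles M" if "is_min_gen_set G M" for G
    using that sub hull_irreducibles[OF M gr]
    unfolding is_min_gen_set_def by blast
qed

section \<open>Integer points of rational rays\<close>

definition coord_sum :: "'a::comm_monoid_add ^ 'p::finite \<Rightarrow> 'a" where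
  "coord_sum x = (\<Sum>k\<in>UNIV. x $ k)"

lemma coord_sum_add: "coord_sum (x + y) = coord_sum x + coord_sum y"
  by (simp add: coord_sum_def sum.distrib)

lemma coord_sum_scaleR: "coord_sum (r *\<^sub>R x) = r * coord_sum (x :: real ^ 'p::finite)"
  by (simp add: coord_sum_def sum_distrib_left)

lemma coord_sum_nat_eq_0_iff: "coord_sum (x :: nat ^ 'p::finite) = 0 \<longleftrightarrow> x = 0"
  by (auto simp: coord_sum_def vec_eq_iff)

lemma coord_sum_pos:
  assumes "\<forall>k. 0 \<le> x $ k" "x \<noteq> (0 :: real ^ 'p::finite)"
  shows "0 < coord_sum x"
proof -
  obtain k where "x $ k \<noteq> 0" using assms(2) by (auto simp: vec_eq_iff)
  then have "0 < x $ k" using assms(1) by (simp add: order_less_le)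
  then show ?thesis
    unfolding coord_sum_def using assms(1) by (intro sum_pos2[of UNIV k]) auto
qed

lemma graded_by_coord_sum: "graded_by coord_sum (M :: (nat ^ 'p::finite) set)"
  by (simp add: graded_by_def coord_sum_add coord_sum_nat_eq_0_iff)

lemma of_nat_vec_component [simp]: "of_nat_vec x $ k = of_nat (x $ k)"
  by (simp add: of_nat_vec_def)

lemma of_nat_vec_add: "of_nat_vec (x + y) = of_nat_vec x + of_nat_vec y"
  by (simp add: vec_eq_iff)

lemma of_nat_vec_0 [simp]: "of_nat_vec 0 = 0"
  by (simp add: vec_eq_iff)

lemma of_nat_vec_smult:
  "(of_nat_vec (n *s x) :: real ^ 'p::finite) = real n *\<^sub>R of_nat_vec x"
  by (simp add: vec_eq_iff)

lemma of_nat_vec_eq_0_iff: "(of_nat_vec x :: real ^ 'p::finite) = 0 \<longleftrightarrow> x = 0"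
  by (simp add: vec_eq_iff)

lemma coord_sum_of_nat_vec: "coord_sum (of_nat_vec x :: real ^ 'p::finite) = real (coord_sum x)"
  by (simp add: coord_sum_def)

definition ray :: "real ^ 'p::finite \<Rightarrow> (real ^ 'p) set" where
  "ray x = {l *\<^sub>R x | l. 0 \<le> l}"

lemma ray_scaleR_pos:
  assumes "0 < r"
  shows "ray (r *\<^sub>R x) = ray x"
proof
  show "ray (r *\<^sub>R x) \<subseteq> ray x"
  proof
    fix y assume "y \<in> ray (r *\<^sub>R x)"
    then obtain l where "0 \<le> l" "y = l *\<^sub>R r *\<^sub>R x" by (auto simp: ray_def)
    then have "0 \<le> l * r" "y = (l * r) *\<^sub>R x" using assms by auto
    then show "y \<in> ray x" unfolding ray_def by blast
  qed
  show "ray x \<subseteq> ray (r *\<^sub>R x)"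
  proof
    fix y assume "y \<in> ray x"
    then obtain l where "0 \<le> l" "y = l *\<^sub>R x" by (auto simp: ray_def)
    then have "0 \<le> l / r" "y = (l / r) *\<^sub>R (r *\<^sub>R x)" using assms by auto
    then show "y \<in> ray (r *\<^sub>R x)" unfolding ray_def by blast
  qed
qed

text \<open>
  A face through a point \<open>x \<noteq> 0\<close> contains the ray of \<open>x\<close>, since \<open>x\<close> lies strictly between \<open>0\<close>
  and its large multiples; dimension one and non-negativity leave no room for further points.
\<close>

lemma edge_eq_ray:
  assumes L: "convex_cone L" "L \<subseteq> {x. \<forall>k. 0 \<le> x $ k}"
    and R: "R edge_of L" and x: "x \<in> R" "x \<noteq> 0"
  shows "R = ray x"
proof
  have face: "R face_of L" and RL: "R \<subseteq> L" and cvx: "convex R" and dim: "aff_dim R = 1"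
    using R by (auto simp: edge_of_def face_of_def)
  have conic: "conic L" and L0: "0 \<in> L"
    using L(1) by (auto simp: convex_cone_def convex_cone_contains_0)
  have mult: "0 \<in> R \<and> m *\<^sub>R x \<in> R" if "m > 1" for m
  proof -
    have "x \<in> open_segment 0 (m *\<^sub>R x)"
      using that x(2) by (auto simp: in_segment intro!: exI[of _ "1 / m"])
    moreover have "m *\<^sub>R x \<in> L"
      using conicD[OF conic] x(1) RL that by auto
    ultimately show ?thesis
      using face x(1) L0 unfolding face_of_def by blast
  qed
  show "ray x \<subseteq> R"
  proof
    fix y assume "y \<in> ray x"
    then obtain l where l: "0 \<le> l" "y = l *\<^sub>R x" by (auto simp: ray_def)
    have "0 \<in> R" "(l + 2) *\<^sub>R x \<in> R" using mult[of "l + 2"] l(1) by auto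
    from convexD_alt[OF cvx this, of "l / (l + 2)"] show "y \<in> R"
      using l by simp
  qed
  show "R \<subseteq> ray x"
  proof
    fix y assume y: "y \<in> R"
    have "0 \<in> R" using mult[of 2] by simp
    then have "collinear {0, x, y}"
      using collinear_subset[of R "{0, x, y}"] dim x y by (simp add: collinear_aff_dim)
    then obtain r where r: "y = r *\<^sub>R x"
      using x(2) by (metis collinear_lemma scaleR_zero_left)
    obtain k where "x $ k \<noteq> 0" using x(2) by (auto simp: vec_eq_iff)
    moreover have "0 \<le> x $ k" "0 \<le> r * x $ k"
      using L(2) RL x(1) y r by auto
    ultimately have "0 \<le> r" by (simp add: zero_le_mult_iff)
    then show "y \<in> ray x" using r by (auto simp: ray_def)
  qed
qed

lemma rational_vec_common_denominator:
  fixes x :: "real ^ 'p::finite"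
  assumes "\<forall>k. x $ k \<in> \<rat>" "\<forall>k. 0 \<le> x $ k"
  obtains d :: nat and a :: "nat ^ 'p" where "d > 0" "of_nat_vec a = real d *\<^sub>R x"
proof -
  \<comment> \<open>The product of denominators of all coordinates serves as a common denominator.\<close>
  have "\<exists>d::nat. d > 0 \<and> (\<exists>n::nat. real d * x $ k = real n)" for k
  proof -
    obtain m n :: nat where "n \<noteq> 0" "\<bar>x $ k\<bar> = real m / real n"
      using assms(1) Rats_abs_nat_div_natE by metis
    then show ?thesis
      using assms(2) by (intro exI[of _ n]) (auto simp: field_simps)
  qed
  then obtain f g where f: "\<And>k. f k > (0::nat)" and g: "\<And>k. real (f k) * x $ k = real (g k)"
    by metis
  define d where "d = (\<Prod>k\<in>UNIV. f k)"
  define a :: "nat ^ 'p" where "a = (\<chi> k. (\<Prod>j\<in>UNIV - {k}. f j) * g k)"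
  have "real (a $ k) = real d * x $ k" for k
  proof -
    have "d = f k * (\<Prod>j\<in>UNIV - {k}. f j)"
      unfolding d_def by (rule prod.remove) auto
    then show ?thesis
      by (simp add: a_def flip: g)
  qed
  then have "of_nat_vec a = real d *\<^sub>R x"
    by (simp add: vec_eq_iff)
  moreover have "d > 0" using f by (simp add: d_def prod_pos)
  ultimately show ?thesis using that by blast
qed

text \<open>
  Among the integer vectors spanning the edge, one of least coordinate sum works: every integer
  point of the edge is \<open>r\<close> times it with \<open>r \<ge> 0\<close>, and a non-zero fractional part of \<open>r\<close>
  would give a spanning vector of smaller coordinate sum.
\<close>

lemma ray_gen_edge:
  fixes L :: "(real ^ 'p::finite) set"
  assumes cone: "rational_polyhedral_cone L" and R: "R edge_of L"
  shows "ray_gen R \<noteq> 0" "R = ray (of_nat_vec (ray_gen R))"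
    "of_nat_vec P \<in> R \<Longrightarrow> \<exists>n. P = n *s ray_gen R"
proof -
  have L: "convex_cone L" "L \<subseteq> {x. \<forall>k. 0 \<le> x $ k}"
    using cone by (auto simp: rational_polyhedral_cone_def)
  have RL: "R \<subseteq> L" using R by (rule edge_of_imp_subset)
  let ?spans = "\<lambda>a::nat ^ 'p. a \<noteq> 0 \<and> R = ray (of_nat_vec a)"
  obtain x where x: "x \<in> R" "x \<noteq> 0" "\<forall>k. x $ k \<in> \<rat>"
    using cone R by (auto simp: rational_polyhedral_cone_def)
  moreover have "\<forall>k. 0 \<le> x $ k" using x(1) RL L(2) by auto
  ultimately obtain d and b :: "nat ^ 'p" where b: "d > 0" "of_nat_vec b = real d *\<^sub>R x"
    using rational_vec_common_denominator by blast
  have "b \<noteq> 0" using b x(2) by (auto simp flip: of_nat_vec_eq_0_iff)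
  moreover have "R = ray (of_nat_vec b)"
    using edge_eq_ray[OF L R x(1,2)] b by (simp add: ray_scaleR_pos)
  ultimately have "?spans b" by simp
  then obtain a where a: "?spans a" and least: "\<And>a'. ?spans a' \<Longrightarrow> coord_sum a \<le> coord_sum a'"
    using ex_has_least_nat[of ?spans b coord_sum] by blast
  have spans: "?spans P" if "of_nat_vec P \<in> R" "P \<noteq> 0" for P
    using edge_eq_ray[OF L R that(1)] that(2) by (auto simp: of_nat_vec_eq_0_iff)
  have multiple: "\<exists>n. P = n *s a \<and> (P \<noteq> 0 \<longrightarrow> n \<noteq> 0)" if P: "of_nat_vec P \<in> R" for P
  proof -
    have "of_nat_vec P \<in> ray (of_nat_vec a)" using P a by auto
    then obtain r where r: "0 \<le> r" "of_nat_vec P = r *\<^sub>R (of_nat_vec a :: real ^ 'p)"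
      by (auto simp: ray_def)
    define n where "n = nat \<lfloor>r\<rfloor>"
    have n: "real n \<le> r" "r < real n + 1"
      using r(1) by (auto simp: n_def)
    have comp: "real (P $ k) = r * real (a $ k)" for k
      using arg_cong[OF r(2), of "\<lambda>v. v $ k"] by simp
    have le: "n * a $ k \<le> P $ k" for k
    proof -
      have "real n * real (a $ k) \<le> real (P $ k)"
        unfolding comp by (intro mult_right_mono n) simp
      then show ?thesis by (simp flip: of_nat_mult)
    qed
    define Q :: "nat ^ 'p" where "Q = (\<chi> k. P $ k - n * a $ k)"
    have Q: "of_nat_vec Q = (r - real n) *\<^sub>R (of_nat_vec a :: real ^ 'p)"
      using le by (simp add: vec_eq_iff Q_def of_nat_diff comp left_diff_distrib)
    have "Q = 0"
    proof (rule ccontr)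
      assume "Q \<noteq> 0"
      moreover have "of_nat_vec Q \<in> R"
        unfolding Q using a n by (auto simp: ray_def intro!: exI[of _ "r - real n"])
      ultimately have "real (coord_sum a) \<le> real (coord_sum Q)"
        using spans least by simp
      also have "\<dots> = (r - real n) * real (coord_sum a)"
        by (metis Q coord_sum_of_nat_vec coord_sum_scaleR)
      finally have "1 \<le> r - real n"
        using a coord_sum_nat_eq_0_iff[of a] by (simp add: mult_le_cancel_right1)
      then show False using n by simp
    qed
    have "P = n *s a"
      using le \<open>Q = 0\<close> by (auto simp: vec_eq_iff Q_def intro: antisym)
    then show ?thesis by (intro exI[of _ n]) (cases n; auto)
  qed
  have "ray_gen R = a"
    unfolding ray_gen_def ray_def[symmetric]
  proof (rule Least_equality)
    show "?spans a" by (rule a)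
    fix a' assume a': "?spans a'"
    have "of_nat_vec a' \<in> R"
      using a' by (auto simp: ray_def intro!: exI[of _ 1])
    then obtain n where "a' = n *s a" "n \<noteq> 0" using multiple a' by blast
    then show "a \<le> a'" by (simp add: less_eq_vec_def)
  qed
  then show "ray_gen R \<noteq> 0" "R = ray (of_nat_vec (ray_gen R))"
    "of_nat_vec P \<in> R \<Longrightarrow> \<exists>n. P = n *s ray_gen R"
    using a multiple by auto
qed

section \<open>The cone is spanned by its extremal rays\<close>

text \<open>
  If a point of the ray of \<open>v\<close> lies strictly between points \<open>a\<close> and \<open>b\<close> of the cone, rescaling to coordinate
  sum one puts \<open>v\<close> between the rescaled \<open>a\<close> and \<open>b\<close>; extremality makes these two equal to \<open>v\<close>. The origin
  cannot be rescaled and is treated apart.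
\<close>

lemma ray_of_extreme_point_edge:
  fixes L :: "(real ^ 'p::finite) set"
  assumes L: "convex_cone L" "L \<subseteq> {x. \<forall>k. 0 \<le> x $ k}"
    and v: "v extreme_point_of (L \<inter> {x. coord_sum x = 1})"
  shows "ray v edge_of L"
proof -
  have conic: "conic L" using L(1) by (simp add: convex_cone_def)
  have vL: "v \<in> L" "coord_sum v = 1" using v by (auto simp: extreme_point_of_def)
  then have v0: "v \<noteq> 0" by (auto simp: coord_sum_def)
  have cvx: "convex (ray v)"
  proof (rule convexI)
    fix x y and r s :: real
    assume "x \<in> ray v" "y \<in> ray v" "0 \<le> r" "0 \<le> s" "r + s = 1"
    then obtain l l' where "0 \<le> l" "x = l *\<^sub>R v" "0 \<le> l'" "y = l' *\<^sub>R v"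
      by (auto simp: ray_def)
    then have "r *\<^sub>R x + s *\<^sub>R y = (r * l + s * l') *\<^sub>R v" "0 \<le> r * l + s * l'"
      using \<open>0 \<le> r\<close> \<open>0 \<le> s\<close> by (simp_all add: scaleR_add_left)
    then show "r *\<^sub>R x + s *\<^sub>R y \<in> ray v"
      unfolding ray_def by blast
  qed
  have mult_in_ray: "r *\<^sub>R v \<in> ray v" if "0 \<le> r" for r
    using that by (auto simp: ray_def)
  have in_ray: "y \<in> ray v" if "y \<in> L" "y \<noteq> 0" "(1 / coord_sum y) *\<^sub>R y = v" for y
  proof -
    have "0 < coord_sum y" using that L(2) by (intro coord_sum_pos) auto
    then show ?thesis using that(3) by (auto simp: ray_def intro!: exI[of _ "coord_sum y"])
  qed
  have face: "a \<in> ray v \<and> b \<in> ray v"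
    if ab: "a \<in> L" "b \<in> L" "x \<in> ray v" "x \<in> open_segment a b" for a b x
  proof -
    obtain l where l: "0 \<le> l" "x = l *\<^sub>R v" using ab(3) by (auto simp: ray_def)
    obtain u where u: "0 < u" "u < 1" "x = (1 - u) *\<^sub>R a + u *\<^sub>R b"
      using ab(4) by (auto simp: in_segment)
    consider "a = 0" | "b = 0" | "a \<noteq> 0" "b \<noteq> 0" by blast
    then show ?thesis
    proof cases
      case 1
      then have "b = (l / u) *\<^sub>R v"
        using l u by (simp add: vec_eq_iff field_simps)
      then show ?thesis
        using 1 l u mult_in_ray[of 0] mult_in_ray[of "l / u"] by simp
    next
      case 2
      then have "a = (l / (1 - u)) *\<^sub>R v"
        using l u by (simp add: vec_eq_iff field_simps)
      then show ?thesis
        using 2 l u mult_in_ray[of 0] mult_in_ray[of "l / (1 - u)"] by simp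
    next
      case 3
      define A where "A = coord_sum a"
      define B where "B = coord_sum b"
      have pos: "0 < A" "0 < B"
        unfolding A_def B_def using ab 3 L(2) by (auto intro!: coord_sum_pos)
      have "coord_sum x = (1 - u) * A + u * B"
        unfolding u(3) A_def B_def by (simp only: coord_sum_add coord_sum_scaleR)
      moreover have "coord_sum x = l"
        unfolding l(2) by (simp only: coord_sum_scaleR vL mult_1_right)
      ultimately have lAB: "l = (1 - u) * A + u * B" by simp
      have lpos: "0 < l" unfolding lAB using pos u by (intro add_pos_pos mult_pos_pos) auto
      \<comment> \<open>The weight of the rescaled \<open>b\<close>: passing to the slice multiplies the weights by the coordinate sums.\<close>
      define w where "w = u * B / l"
      have w: "0 < w" "w < 1" "1 - w = (1 - u) * A / l"
        using pos u lpos unfolding w_def by (auto simp: lAB field_simps)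
      have slice: "(1 / A) *\<^sub>R a \<in> L \<inter> {x. coord_sum x = 1}" "(1 / B) *\<^sub>R b \<in> L \<inter> {x. coord_sum x = 1}"
        using pos ab conicD[OF conic] by (auto simp: coord_sum_scaleR A_def B_def)
      have coeff: "(1 / l) * (1 - u) = (1 - w) * (1 / A)" "(1 / l) * u = w * (1 / B)"
        unfolding w(3) unfolding w_def using pos lpos by simp_all
      have "v = (1 / l) *\<^sub>R x" using l lpos by simp
      also have "\<dots> = (1 - w) *\<^sub>R ((1 / A) *\<^sub>R a) + w *\<^sub>R ((1 / B) *\<^sub>R b)"
        unfolding u(3) scaleR_add_right scaleR_scaleR coeff ..
      finally have vw: "v = (1 - w) *\<^sub>R ((1 / A) *\<^sub>R a) + w *\<^sub>R ((1 / B) *\<^sub>R b)" .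
      have "v \<notin> open_segment ((1 / A) *\<^sub>R a) ((1 / B) *\<^sub>R b)"
        using v slice unfolding extreme_point_of_def by blast
      then have eq: "(1 / A) *\<^sub>R a = (1 / B) *\<^sub>R b"
        using vw w(1,2) by (auto simp: in_segment)
      have "v = (1 / B) *\<^sub>R b"
        using vw unfolding eq by (simp only: flip: scaleR_add_left) simp
      then have "(1 / A) *\<^sub>R a = v" "(1 / B) *\<^sub>R b = v"
        using eq by simp_all
      then show ?thesis
        using in_ray ab 3 by (simp add: A_def B_def)
    qed
  qed
  have "ray v \<subseteq> L" using conicD[OF conic vL(1)] by (auto simp: ray_def)
  then have "ray v face_of L"
    unfolding face_of_def using cvx face by blast
  moreover have "aff_dim (ray v) = 1"
  proof (rule antisym)
    have "\<exists>r. x - y = r *\<^sub>R v" if xy: "x \<in> ray v" "y \<in> ray v" for x y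
    proof -
      obtain l l' where "x = l *\<^sub>R v" "y = l' *\<^sub>R v"
        using xy unfolding ray_def by blast
      then show ?thesis
        by (intro exI[of _ "l - l'"]) (simp add: scaleR_diff_left)
    qed
    then have "collinear (ray v)"
      unfolding collinear_def by blast
    then show "aff_dim (ray v) \<le> 1" by (simp add: collinear_aff_dim)
    have "{0, v} \<subseteq> ray v" using mult_in_ray[of 0] mult_in_ray[of 1] by simp
    then show "1 \<le> aff_dim (ray v)"
      using aff_dim_subset[of "{0, v}" "ray v"] v0 by (simp add: aff_dim_2)
  qed
  ultimately show ?thesis by (simp add: edge_of_def)
qed

text \<open>
  The slice of the cone by the hyperplane of coordinate sum one is a compact convex set, hence the
  convex hull of its extreme points, and these lie on the extremal rays.
\<close>

lemma cone_eq_sum_of_extremal_rays: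
  fixes L :: "(real ^ 'p::finite) set"
  assumes cone: "rational_polyhedral_cone L" and \<tau>: "bij_betw \<tau> {1..q} {R. R edge_of L}"
    and x: "x \<in> L"
  shows "\<exists>m. (\<forall>i\<in>{1..q}. 0 \<le> m i) \<and> x = (\<Sum>i\<in>{1..q::nat}. m i *\<^sub>R of_nat_vec (ray_gen (\<tau> i)))"
proof -
  have L: "convex_cone L" "L \<subseteq> {x. \<forall>k. 0 \<le> x $ k}" and poly: "polyhedron L"
    using cone by (auto simp: rational_polyhedral_cone_def)
  have conic: "conic L" and cvxL: "convex L" using L(1) by (auto simp: convex_cone_def)
  define N where "N = {y. \<exists>m. (\<forall>i\<in>{1..q}. 0 \<le> m i) \<and>
    y = (\<Sum>i\<in>{1..q}. m i *\<^sub>R (of_nat_vec (ray_gen (\<tau> i)) :: real ^ 'p))}"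
  have scale: "r *\<^sub>R y \<in> N" if "0 \<le> r" "y \<in> N" for r y
  proof -
    obtain m where "\<forall>i\<in>{1..q}. 0 \<le> m i" "y = (\<Sum>i\<in>{1..q}. m i *\<^sub>R of_nat_vec (ray_gen (\<tau> i)))"
      using \<open>y \<in> N\<close> unfolding N_def by blast
    then show ?thesis
      unfolding N_def using \<open>0 \<le> r\<close>
      by (intro CollectI exI[of _ "\<lambda>i. r * m i"]) (auto simp: scaleR_sum_right)
  qed
  have add: "y + z \<in> N" if "y \<in> N" "z \<in> N" for y z
  proof -
    obtain m m' where "\<forall>i\<in>{1..q}. 0 \<le> m i" "y = (\<Sum>i\<in>{1..q}. m i *\<^sub>R of_nat_vec (ray_gen (\<tau> i)))"
      "\<forall>i\<in>{1..q}. 0 \<le> m' i" "z = (\<Sum>i\<in>{1..q}. m' i *\<^sub>R of_nat_vec (ray_gen (\<tau> i)))"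
      using \<open>y \<in> N\<close> \<open>z \<in> N\<close> unfolding N_def by blast
    then show ?thesis
      unfolding N_def
      by (intro CollectI exI[of _ "\<lambda>i. m i + m' i"]) (auto simp: scaleR_add_left sum.distrib)
  qed
  have cvxN: "convex N"
    unfolding convex_def using scale add by blast
  define K where "K = L \<inter> {x. coord_sum x = 1}"
  have "v \<in> N" if "v extreme_point_of K" for v
  proof -
    have "ray v edge_of L"
      using ray_of_extreme_point_edge[OF L] that by (simp add: K_def)
    then have "ray v \<in> \<tau> ` {1..q}"
      using bij_betw_imp_surj_on[OF \<tau>] by simp
    then obtain i where i: "i \<in> {1..q}" "\<tau> i = ray v" by blast
    have "v \<in> \<tau> i" unfolding i by (auto simp: ray_def intro: exI[of _ 1])
    moreover have "\<tau> i = ray (of_nat_vec (ray_gen (\<tau> i)))"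
      using ray_gen_edge(2)[OF cone] i \<open>ray v edge_of L\<close> by metis
    ultimately obtain r where r: "0 \<le> r" "v = r *\<^sub>R of_nat_vec (ray_gen (\<tau> i))"
      by (auto simp: ray_def)
    have "v = (\<Sum>j\<in>{1..q}. (if j = i then r else 0) *\<^sub>R of_nat_vec (ray_gen (\<tau> j)))"
      using i(1) r by (simp add: if_distrib[of "\<lambda>a. a *\<^sub>R _"] sum.delta cong: if_cong)
    then show ?thesis
      unfolding N_def using r(1) by (intro CollectI exI[of _ "\<lambda>j. if j = i then r else 0"]) auto
  qed
  then have hull: "convex hull {v. v extreme_point_of K} \<subseteq> N"
    by (intro hull_minimal cvxN) auto
  have "convex {x :: real ^ 'p. coord_sum x = 1}"
    by (auto simp: convex_def coord_sum_add coord_sum_scaleR)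
  then have "convex K" unfolding K_def by (intro convex_Int cvxL)
  moreover have "compact K"
  proof -
    have "closed {x :: real ^ 'p. coord_sum x = 1}"
      unfolding coord_sum_def by (intro closed_Collect_eq continuous_intros)
    then have "closed K"
      unfolding K_def by (intro closed_Int polyhedron_imp_closed[OF poly])
    moreover have "K \<subseteq> cbox 0 1"
    proof
      fix y assume "y \<in> K"
      then have y: "\<forall>k. 0 \<le> y $ k" "coord_sum y = 1" using L(2) by (auto simp: K_def)
      have "y $ k \<le> coord_sum y" for k
        unfolding coord_sum_def using y by (intro member_le_sum) auto
      then show "y \<in> cbox 0 1" using y by (simp add: mem_box_cart)
    qed
    ultimately show ?thesis
      using bounded_cbox bounded_subset compact_eq_bounded_closed by blast
  qed
  ultimately have KN: "K \<subseteq> N"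
    using Krein_Milman_Minkowski hull by blast
  have "x \<in> N"
  proof (cases "x = 0")
    case True
    then show ?thesis unfolding N_def by (auto intro!: exI[of _ "\<lambda>_. 0"])
  next
    case False
    then have pos: "0 < coord_sum x" using x L(2) by (intro coord_sum_pos) auto
    have "(1 / coord_sum x) *\<^sub>R x \<in> K"
      using pos x conicD[OF conic] by (auto simp: K_def coord_sum_scaleR)
    then have "coord_sum x *\<^sub>R ((1 / coord_sum x) *\<^sub>R x) \<in> N"
      using KN pos by (intro scale[of "coord_sum x"]) auto
    then show ?thesis using pos by simp
  qed
  then show ?thesis by (simp add: N_def)
qed

section \<open>The linear forms vanishing on an extremal ray\<close>

lemma lin_form_add: "lin_form c (x + y) = lin_form c x + lin_form c y"
  by (simp add: lin_form_def distrib_left sum.distrib)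

lemma lin_form_of_nat_vec:
  "of_int (lin_form c (of_nat_vec P :: int ^ 'p::finite)) = (lin_form c (of_nat_vec P :: real ^ 'p))"
  by (simp add: lin_form_def)

locale extremal_rays =
  fixes L :: "(real ^ 'p::finite) set"
    and c :: "nat \<Rightarrow> int ^ 'p"
    and \<tau> :: "nat \<Rightarrow> (real ^ 'p) set"
    and t q :: nat
  assumes cone: "rational_polyhedral_cone L"
    and hyperplanes: "supported_hyperplanes L t c"
    and rays: "bij_betw \<tau> {1..q} {R. R edge_of L}"
    and determined: "\<forall>i\<in>{1..q}. ray_determined t c (\<tau> i)"
begin

abbreviation "a i \<equiv> ray_gen (\<tau> i)"
abbreviation "\<Upsilon> i \<equiv> Upsilon t c (\<tau> i)"
abbreviation "T i \<equiv> T_monoid t c q \<tau> i"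
abbreviation "\<C> \<equiv> int_cone L"
abbreviation "\<A> \<equiv> ray_zonotope q \<tau>"

lemma cone_props: "convex_cone L" "L \<subseteq> {x. \<forall>k. 0 \<le> x $ k}"
  using cone by (auto simp: rational_polyhedral_cone_def)

lemma edge: "i \<in> {1..q} \<Longrightarrow> \<tau> i edge_of L"
  using bij_betw_apply[OF rays] by simp

lemma gen_nonzero: "i \<in> {1..q} \<Longrightarrow> a i \<noteq> 0"
  and ray_eq: "i \<in> {1..q} \<Longrightarrow> \<tau> i = ray (of_nat_vec (a i))"
  and ray_multiple: "i \<in> {1..q} \<Longrightarrow> of_nat_vec P \<in> \<tau> i \<Longrightarrow> \<exists>n. P = n *s a i"
  using ray_gen_edge[OF cone edge] by blast+

lemma multiple_in_ray: "i \<in> {1..q} \<Longrightarrow> of_nat_vec (n *s a i) \<in> \<tau> i"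
  by (subst ray_eq) (auto simp: ray_def of_nat_vec_smult)

lemma multiple_in_cone: "i \<in> {1..q} \<Longrightarrow> n *s a i \<in> \<C>"
  using multiple_in_ray edge_of_imp_subset[OF edge] by (auto simp: int_cone_def)

lemma gen_in_cone: "i \<in> {1..q} \<Longrightarrow> a i \<in> \<C>"
  by (metis multiple_in_cone vector_smult_lid)

lemma gen_notin_other_ray:
  assumes "i \<in> {1..q}" "j \<in> {1..q}" "i \<noteq> j"
  shows "of_nat_vec (a i) \<notin> \<tau> j"
proof
  assume "of_nat_vec (a i) \<in> \<tau> j"
  then have "\<tau> j = ray (of_nat_vec (a i))"
    using edge_eq_ray[OF cone_props edge] gen_nonzero assms by (simp add: of_nat_vec_eq_0_iff)
  then show False
    using ray_eq assms bij_betw_imp_inj_on[OF rays] by (metis inj_onD)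
qed

lemma int_cone_add: "P \<in> \<C> \<Longrightarrow> Q \<in> \<C> \<Longrightarrow> P + Q \<in> \<C>"
  using cone_props(1) by (auto simp: int_cone_def of_nat_vec_add intro: convex_cone_add)

lemma int_cone_0: "0 \<in> \<C>"
  using cone_props(1) by (simp add: int_cone_def convex_cone_contains_0)

lemma nonneg_combination_in_cone:
  assumes "\<forall>i\<in>I. 0 \<le> m i" "I \<subseteq> {1..q}"
  shows "(\<Sum>i\<in>I. m i *\<^sub>R of_nat_vec (a i)) \<in> L"
proof -
  have "finite I" using assms(2) by (rule finite_subset) simp
  then show ?thesis
    using assms
  proof (induction I)
    case empty
    then show ?case using cone_props(1) by (simp add: convex_cone_contains_0)
  next
    case (insert i I)
    have "m i *\<^sub>R of_nat_vec (a i) \<in> L"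
      using insert.prems gen_in_cone cone_props(1)
      by (auto simp: int_cone_def convex_cone_def conicD)
    then show ?case
      using insert cone_props(1) by (auto intro!: convex_cone_add)
  qed
qed

lemma zonotope_subset_cone: "\<A> \<subseteq> \<C>"
  using nonneg_combination_in_cone[of "{1..q}"] by (auto simp: ray_zonotope_def int_cone_def)

lemma sum_gens_in_zonotope:
  assumes "I \<subseteq> {1..q}"
  shows "(\<Sum>i\<in>I. a i) \<in> \<A>"
proof -
  have fin: "finite I" using assms by (rule finite_subset) simp
  have "of_nat_vec (\<Sum>i\<in>I. a i) = (\<Sum>i\<in>I. of_nat_vec (a i) :: real ^ 'p)"
    by (simp add: vec_eq_iff)
  also have "\<dots> = (\<Sum>i\<in>I. (if i \<in> I then 1 else 0) *\<^sub>R of_nat_vec (a i))"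
    by (intro sum.cong) auto
  also have "\<dots> = (\<Sum>i\<in>{1..q}. (if i \<in> I then 1 else 0) *\<^sub>R of_nat_vec (a i))"
    using assms by (intro sum.mono_neutral_left) auto
  finally show ?thesis
    unfolding ray_zonotope_def
    by (intro CollectI exI[of _ "\<lambda>i. if i \<in> I then 1 else 0"]) auto
qed

text \<open>
  A point of the cone has non-negative coordinates with respect to the vectors \<open>a i\<close>; outside of
  the zonotope one of them exceeds 1, so the corresponding vector can be subtracted.
\<close>

lemma outside_zonotope_split:
  assumes P: "P \<in> \<C>" "P \<notin> \<A>"
  obtains i Q where "i \<in> {1..q}" "Q \<in> \<C>" "Q \<noteq> 0" "P = a i + Q"
proof -
  obtain m where m: "\<forall>i\<in>{1..q}. 0 \<le> m i"
    "of_nat_vec P = (\<Sum>i\<in>{1..q}. m i *\<^sub>R (of_nat_vec (a i) :: real ^ 'p))"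
    using cone_eq_sum_of_extremal_rays[OF cone rays, of "of_nat_vec P"] P(1)
    by (auto simp: int_cone_def)
  have "\<not> (\<forall>i\<in>{1..q}. m i \<le> 1)"
    using P(2) m unfolding ray_zonotope_def by blast
  then obtain i where i: "i \<in> {1..q}" "1 < m i" by (meson not_le)
  define m' where "m' = (\<lambda>j. if j = i then m i - 1 else m j)"
  have m': "\<forall>j\<in>{1..q}. 0 \<le> m' j" using m(1) i by (auto simp: m'_def)
  have "of_nat_vec P = m i *\<^sub>R of_nat_vec (a i) + (\<Sum>j\<in>{1..q} - {i}. m j *\<^sub>R (of_nat_vec (a j) :: real ^ 'p))"
    unfolding m(2) using i(1) by (intro sum.remove) auto
  also have "(\<Sum>j\<in>{1..q} - {i}. m j *\<^sub>R (of_nat_vec (a j) :: real ^ 'p)) =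
      (\<Sum>j\<in>{1..q} - {i}. m' j *\<^sub>R of_nat_vec (a j))"
    by (intro sum.cong) (auto simp: m'_def)
  also have "m i *\<^sub>R of_nat_vec (a i) + (\<Sum>j\<in>{1..q} - {i}. m' j *\<^sub>R (of_nat_vec (a j) :: real ^ 'p)) =
      of_nat_vec (a i) + (m' i *\<^sub>R of_nat_vec (a i) + (\<Sum>j\<in>{1..q} - {i}. m' j *\<^sub>R of_nat_vec (a j)))"
    by (simp add: m'_def scaleR_diff_left)
  also have "m' i *\<^sub>R of_nat_vec (a i) + (\<Sum>j\<in>{1..q} - {i}. m' j *\<^sub>R of_nat_vec (a j)) =
      (\<Sum>j\<in>{1..q}. m' j *\<^sub>R (of_nat_vec (a j) :: real ^ 'p))" (is "_ = ?y")
    using i(1) by (intro sum.remove[symmetric]) auto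
  finally have split: "of_nat_vec P = of_nat_vec (a i) + ?y" .
  have yL: "?y \<in> L" using m' by (intro nonneg_combination_in_cone) auto
  define Q :: "nat ^ 'p" where "Q = (\<chi> k. P $ k - a i $ k)"
  have comp: "real (P $ k) = real (a i $ k) + ?y $ k" for k
    using arg_cong[OF split, of "\<lambda>v. v $ k"] by simp
  have "0 \<le> ?y $ k" for k using yL cone_props(2) by blast
  then have le: "a i $ k \<le> P $ k" for k
    using comp[of k] by (metis le_add_same_cancel1 of_nat_le_iff)
  have PQ: "P = a i + Q" using le by (simp add: vec_eq_iff Q_def)
  then have "of_nat_vec Q = ?y" using split by (simp add: of_nat_vec_add)
  then have "Q \<in> \<C>" using yL by (simp add: int_cone_def)
  moreover have "Q \<noteq> 0" using PQ P(2) sum_gens_in_zonotope[of "{i}"] i(1) by auto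
  ultimately show ?thesis using that i(1) PQ by blast
qed

text \<open>Splitting off vectors \<open>a i\<close> lowers the coordinate sum and ends inside the zonotope.\<close>

lemma cone_generated_by_zonotope: "\<C> \<subseteq> add_submonoid hull \<A>"
proof
  fix P assume "P \<in> \<C>"
  then show "P \<in> add_submonoid hull \<A>"
  proof (induction "coord_sum P" arbitrary: P rule: less_induct)
    case less
    show ?case
    proof (cases "P \<in> \<A>")
      case True
      then show ?thesis by (rule hull_inc)
    next
      case False
      then obtain i Q where Q: "i \<in> {1..q}" "Q \<in> \<C>" "P = a i + Q"
        using outside_zonotope_split less.prems by blast
      have "coord_sum (a i) \<noteq> 0"
        using gen_nonzero[OF Q(1)] coord_sum_nat_eq_0_iff by blast
      then have "coord_sum Q < coord_sum P"
        by (simp add: Q(3) coord_sum_add)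
      then have "Q \<in> add_submonoid hull \<A>" using less Q(2) by blast
      moreover have "a i \<in> add_submonoid hull \<A>"
        using sum_gens_in_zonotope[of "{i}"] Q(1) by (intro hull_inc) auto
      ultimately show ?thesis
        using add_submonoid_hull[of \<A>] Q(3) by (auto simp: add_submonoid_def)
    qed
  qed
qed

lemma form_nonneg:
  assumes "P \<in> \<C>" "j \<in> {1..t}"
  shows "0 \<le> lin_form (c j) (of_nat_vec P :: int ^ 'p)"
proof -
  have "L = {x. (\<forall>k. 0 \<le> x $ k) \<and> (\<forall>j\<in>{1..t}. 0 \<le> lin_form (c j) x)}"
    using hyperplanes unfolding supported_hyperplanes_def by blast
  then have "0 \<le> lin_form (c j) (of_nat_vec P :: real ^ 'p)"
    using assms unfolding int_cone_def by blast
  then show ?thesis by (simp flip: lin_form_of_nat_vec)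
qed

lemma enum_hyperplanes_through:
  assumes "i \<in> {1..q}"
  defines "js \<equiv> sorted_list_of_set (hyperplanes_through t c (\<tau> i))"
  shows "length js = CARD('p) - 1" "set js = hyperplanes_through t c (\<tau> i)"
proof -
  have "finite (hyperplanes_through t c (\<tau> i))"
    by (simp add: hyperplanes_through_def)
  then show "length js = CARD('p) - 1" "set js = hyperplanes_through t c (\<tau> i)"
    using determined assms(1) by (auto simp: js_def ray_determined_def)
qed

lemma Upsilon_add:
  assumes i: "i \<in> {1..q}" and P: "P \<in> \<C>" and Q: "Q \<in> \<C>"
  shows "\<Upsilon> i (P + Q) = \<Upsilon> i P + \<Upsilon> i Q"
proof
  fix m
  let ?js = "sorted_list_of_set (hyperplanes_through t c (\<tau> i))"
  show "\<Upsilon> i (P + Q) m = (\<Upsilon> i P + \<Upsilon> i Q) m"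
  proof (cases "m < CARD('p) - 1")
    case True
    then have "?js ! m \<in> {1..t}"
      using enum_hyperplanes_through[OF i] nth_mem[of m ?js] by (auto simp: hyperplanes_through_def)
    then show ?thesis
      using True form_nonneg P Q
      by (simp add: Upsilon_def of_nat_vec_add lin_form_add nat_add_distrib)
  qed (simp add: Upsilon_def)
qed

text \<open>
  The forms through \<open>\<tau> i\<close> are non-negative on the cone and have the line spanned by \<open>\<tau> i\<close> as common
  zero set; this line meets the non-negative orthant in \<open>\<tau> i\<close> alone.
\<close>

lemma Upsilon_eq_0_iff:
  assumes i: "i \<in> {1..q}" and P: "P \<in> \<C>"
  shows "\<Upsilon> i P = 0 \<longleftrightarrow> of_nat_vec P \<in> \<tau> i"
proof -
  let ?J = "hyperplanes_through t c (\<tau> i)"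
  let ?js = "sorted_list_of_set ?J"
  note js = enum_hyperplanes_through[OF i]
  have "\<Upsilon> i P = 0 \<longleftrightarrow> (\<forall>m<CARD('p) - 1. lin_form (c (?js ! m)) (of_nat_vec P :: int ^ 'p) \<le> 0)"
    by (auto simp: fun_eq_iff Upsilon_def)
  also have "\<dots> \<longleftrightarrow> (\<forall>j\<in>?J. lin_form (c j) (of_nat_vec P :: int ^ 'p) \<le> 0)"
    using all_set_conv_all_nth[of ?js] by (simp only: js)
  also have "\<dots> \<longleftrightarrow> (\<forall>j\<in>?J. lin_form (c j) (of_nat_vec P :: int ^ 'p) = 0)"
    using form_nonneg[OF P] by (force simp: hyperplanes_through_def intro: antisym)
  also have "\<dots> \<longleftrightarrow> (\<forall>j\<in>?J. lin_form (c j) (of_nat_vec P :: real ^ 'p) = 0)"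
    by (simp flip: lin_form_of_nat_vec)
  also have "\<dots> \<longleftrightarrow> of_nat_vec P \<in> span (\<tau> i)"
    using determined i unfolding ray_determined_def by blast
  also have "\<dots> \<longleftrightarrow> of_nat_vec P \<in> \<tau> i"
  proof
    assume "of_nat_vec P \<in> span (\<tau> i)"
    moreover have "\<tau> i \<subseteq> span {of_nat_vec (a i)}"
      by (subst ray_eq[OF i]) (auto simp: ray_def intro: span_mul span_base)
    then have "span (\<tau> i) \<subseteq> span {of_nat_vec (a i)}"
      by (simp add: span_minimal)
    ultimately obtain r where r: "of_nat_vec P = r *\<^sub>R (of_nat_vec (a i) :: real ^ 'p)"
      by (auto simp: span_singleton)
    obtain k where "a i $ k \<noteq> 0" using gen_nonzero[OF i] by (auto simp: vec_eq_iff)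
    moreover have "real (P $ k) = r * real (a i $ k)"
      using arg_cong[OF r, of "\<lambda>v. v $ k"] by simp
    ultimately have "0 \<le> r"
      by (metis of_nat_0_le_iff of_nat_0_less_iff not_gr_zero zero_le_mult_iff not_le)
    then show "of_nat_vec P \<in> \<tau> i"
      by (subst ray_eq[OF i]) (auto simp: ray_def r)
  qed (rule span_base)
  finally show ?thesis .
qed

lemma summands_in_ray:
  assumes "i \<in> {1..q}" "P \<in> \<C>" "Q \<in> \<C>" "of_nat_vec (P + Q) \<in> \<tau> i"
  shows "of_nat_vec P \<in> \<tau> i" "of_nat_vec Q \<in> \<tau> i"
proof -
  have "\<Upsilon> i P + \<Upsilon> i Q = 0"
    using assms by (simp add: Upsilon_eq_0_iff int_cone_add flip: Upsilon_add)
  then have "\<Upsilon> i P = 0" "\<Upsilon> i Q = 0" by (auto simp: fun_eq_iff)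
  then show "of_nat_vec P \<in> \<tau> i" "of_nat_vec Q \<in> \<tau> i"
    using assms by (simp_all add: Upsilon_eq_0_iff)
qed

section \<open>The monoids of the extremal rays\<close>

lemma T_submonoid: "add_submonoid (T i)"
  unfolding T_monoid_def by (rule add_submonoid_hull)

lemma Upsilon_in_T:
  assumes i: "i \<in> {1..q}" and P: "P \<in> \<C>"
  shows "\<Upsilon> i P \<in> T i"
proof -
  have T: "0 \<in> T i" "\<And>x y. x \<in> T i \<Longrightarrow> y \<in> T i \<Longrightarrow> x + y \<in> T i"
    using T_submonoid[of i] by (auto simp: add_submonoid_def)
  let ?D = "{P \<in> \<C>. \<Upsilon> i P \<in> T i}"
  have "\<Upsilon> i 0 = 0"
    using multiple_in_ray[OF i, of 0] by (simp add: Upsilon_eq_0_iff[OF i] int_cone_0)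
  then have "add_submonoid ?D"
    using T by (auto simp: add_submonoid_def int_cone_add int_cone_0 Upsilon_add[OF i])
  moreover have "\<A> \<subseteq> ?D"
    using zonotope_subset_cone by (auto simp: T_monoid_def intro: hull_inc)
  ultimately have "add_submonoid hull \<A> \<subseteq> ?D" by (intro hull_minimal)
  then show ?thesis using P cone_generated_by_zonotope by blast
qed

lemma min_gens_T: "min_gens (T i) = irreducibles (T i)"
proof (rule min_gens_eq_irreducibles[OF T_submonoid])
  have vanish: "T i \<subseteq> {f. \<forall>m. CARD('p) - 1 \<le> m \<longrightarrow> f m = 0}"
    unfolding T_monoid_def
    by (rule hull_minimal) (auto simp: add_submonoid_def Upsilon_def)
  have "f = 0" if "f \<in> T i" "(\<Sum>m<CARD('p) - 1. f m) = 0" for f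
  proof
    fix m
    show "f m = 0 m"
    proof (cases "CARD('p) - 1 \<le> m")
      case True
      then show ?thesis using that(1) vanish by auto
    next
      case False
      then show ?thesis using that(2) by simp
    qed
  qed
  then show "graded_by (\<lambda>f. \<Sum>m<CARD('p) - 1. f m) (T i)"
    unfolding graded_by_def by (simp add: sum.distrib)
qed

text \<open>
  The value at \<open>P + Q\<close> is a sum of two non-zero elements of \<open>T i\<close>, so it is neither zero nor a minimal
  generator.
\<close>

lemma notin_M_set:
  assumes i: "i \<in> {1..q}" and PQ: "P \<in> \<C>" "Q \<in> \<C>" "of_nat_vec P \<notin> \<tau> i" "of_nat_vec Q \<notin> \<tau> i"
  shows "i \<notin> M_set t c q \<tau> (P + Q)"
proof
  assume "i \<in> M_set t c q \<tau> (P + Q)"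
  then consider "\<Upsilon> i (P + Q) = 0" | "\<Upsilon> i (P + Q) \<in> irreducibles (T i)"
    by (auto simp: M_set_def min_gens_T)
  then show False
  proof cases
    case 1
    then have "of_nat_vec (P + Q) \<in> \<tau> i"
      using i PQ by (simp add: Upsilon_eq_0_iff int_cone_add)
    then show False using summands_in_ray i PQ by blast
  next
    case 2
    then have "\<Upsilon> i P = 0 \<or> \<Upsilon> i Q = 0"
      using irreduciblesD(3) Upsilon_in_T Upsilon_add i PQ by metis
    then show False using i PQ by (simp add: Upsilon_eq_0_iff)
  qed
qed

text \<open>
  Write the point as \<open>a i + Q\<close>. Neither summand lies on a ray \<open>\<tau> l\<close> with \<open>l \<noteq> i\<close>, unless \<open>Q\<close> is a
  multiple of some \<open>a j\<close> with \<open>j \<noteq> i\<close>. In that case the factor is at least 2, since \<open>a i + a j\<close> is in the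
  zonotope, and the splitting \<open>(a i + a j) + (n - 1) a j\<close> excludes every ray other than \<open>\<tau> j\<close>.
\<close>

lemma card_M_set_outside_zonotope:
  assumes P: "P \<in> \<C>" "P \<notin> \<A>"
  shows "card (M_set t c q \<tau> P) \<le> 1"
proof -
  obtain i Q where iQ: "i \<in> {1..q}" "Q \<in> \<C>" "Q \<noteq> 0" "P = a i + Q"
    using outside_zonotope_split[OF P] by blast
  have sub: "M_set t c q \<tau> P \<subseteq> {1..q}" by (auto simp: M_set_def)
  have "\<exists>j. M_set t c q \<tau> P \<subseteq> {j}"
  proof (cases "\<exists>j\<in>{1..q} - {i}. of_nat_vec Q \<in> \<tau> j")
    case True
    then obtain j n where j: "j \<in> {1..q}" "j \<noteq> i" and n: "Q = n *s a j"
      using ray_multiple by blast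
    have "n \<noteq> 0" using n iQ(3) by (metis vector_smult_lzero)
    moreover have "n \<noteq> 1"
    proof
      assume "n = 1"
      then have "P = a i + a j" using n iQ(4) by (metis vector_smult_lid)
      then show False using P(2) iQ(1) j sum_gens_in_zonotope[of "{i, j}"] by auto
    qed
    ultimately obtain n' where n': "n = Suc (Suc n')"
      by (metis One_nat_def not0_implies_Suc)
    have P_eq: "P = (a i + a j) + (a j + n' *s a j)"
      by (simp add: iQ(4) n n' vec_eq_iff)
    have "l \<notin> M_set t c q \<tau> P" if l: "l \<in> {1..q}" "l \<noteq> j" for l
    proof -
      have "of_nat_vec (a j) \<notin> \<tau> l" using gen_notin_other_ray j l by blast
      then have "of_nat_vec (a i + a j) \<notin> \<tau> l" "of_nat_vec (a j + n' *s a j) \<notin> \<tau> l"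
        using summands_in_ray(2)[OF l(1) gen_in_cone[OF iQ(1)] gen_in_cone[OF j(1)]]
          summands_in_ray(1)[OF l(1) gen_in_cone[OF j(1)] multiple_in_cone[OF j(1)]] by blast+
      then show ?thesis
        unfolding P_eq using l(1) gen_in_cone iQ(1) j(1) multiple_in_cone
        by (intro notin_M_set int_cone_add) auto
    qed
    then show ?thesis using sub by blast
  next
    case False
    then have "l \<notin> M_set t c q \<tau> P" if "l \<in> {1..q}" "l \<noteq> i" for l
      unfolding iQ(4) using that iQ(1,2) gen_in_cone gen_notin_other_ray
      by (intro notin_M_set) auto
    then show ?thesis using sub by blast
  qed
  then obtain j where "M_set t c q \<tau> P \<subseteq> {j}" by blast
  then show ?thesis using card_mono[of "{j}"] by fastforce
qed

section \<open>Minimal generators of the semigroup seen from one ray\<close>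

lemma S_ray_submonoid:
  assumes "add_submonoid S"
  shows "add_submonoid (S_ray S (\<tau> i))"
  using assms by (auto simp: add_submonoid_def S_ray_def vector_sadd_rdistrib)

lemma min_gens_S_ray:
  assumes "add_submonoid S"
  shows "min_gens (S_ray S (\<tau> i)) = irreducibles (S_ray S (\<tau> i))"
  using S_ray_submonoid[OF assms]
  by (rule min_gens_eq_irreducibles[where \<phi> = id]) (simp add: graded_by_def)

text \<open>A decomposition of \<open>n a i\<close> stays on the ray, so it is a decomposition of \<open>n\<close>.\<close>

lemma multiple_irreducible:
  assumes S: "S \<subseteq> \<C>" and i: "i \<in> {1..q}" and n: "n \<in> irreducibles (S_ray S (\<tau> i))"
  shows "n *s a i \<in> irreducibles S"
proof -
  have "y = 0 \<or> z = 0" if yz: "y \<in> S" "z \<in> S" "n *s a i = y + z" for y z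
  proof -
    have "of_nat_vec y \<in> \<tau> i" "of_nat_vec z \<in> \<tau> i"
      using summands_in_ray[OF i, of y z] yz S multiple_in_ray[OF i, of n] by auto
    then obtain m m' where m: "y = m *s a i" "z = m' *s a i"
      using ray_multiple[OF i] by blast
    obtain k where "a i $ k \<noteq> 0" using gen_nonzero[OF i] by (auto simp: vec_eq_iff)
    moreover have "n * a i $ k = (m + m') * a i $ k"
      using arg_cong[OF yz(3), of "\<lambda>v. v $ k"] by (simp add: m distrib_right)
    ultimately have "n = m + m'" by simp
    then have "m = 0 \<or> m' = 0"
      using irreduciblesD(3)[OF n] yz(1,2) by (auto simp: m S_ray_def)
    then show ?thesis using m by auto
  qed
  moreover have "n *s a i \<noteq> 0"
    using irreduciblesD(2)[OF n] gen_nonzero[OF i] by (auto simp: vec_eq_iff)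
  ultimately show ?thesis
    using irreduciblesD(1)[OF n] by (auto simp: irreducibles_def S_ray_def)
qed

text \<open>
  The generator \<open>\<gamma>\<close> is the image of a point of the zonotope, and adding multiples of \<open>a i\<close> moves this
  point into \<open>S\<close> without changing its image. A smallest point of \<open>S\<close> over \<open>\<gamma>\<close> cannot be decomposed in
  \<open>S\<close>, for one of the summands would lie over \<open>\<gamma>\<close> too.
\<close>

lemma irreducible_over_T_generator:
  assumes S: "S \<subseteq> \<C>" "finite (\<C> - S)" and i: "i \<in> {1..q}"
    and \<gamma>: "\<gamma> \<in> irreducibles (T i)"
  obtains s where "s \<in> irreducibles S" "\<Upsilon> i s = \<gamma>"
proof -
  obtain Q where Q: "Q \<in> \<A>" "\<Upsilon> i Q = \<gamma>"
    using \<gamma> irreducibles_hull_subset unfolding T_monoid_def by blast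
  have QC: "Q \<in> \<C>" using Q(1) zonotope_subset_cone by blast
  define f where "f n = Q + n *s a i" for n
  have fC: "f n \<in> \<C>" for n
    unfolding f_def using QC multiple_in_cone[OF i] by (intro int_cone_add)
  have "inj f"
  proof (rule injI)
    fix m n assume "f m = f n"
    moreover obtain k where "a i $ k \<noteq> 0" using gen_nonzero[OF i] by (auto simp: vec_eq_iff)
    ultimately show "m = n" by (auto simp: f_def vec_eq_iff)
  qed
  then have "infinite (range f)" by (simp add: finite_image_iff)
  then have "\<not> range f \<subseteq> \<C> - S" using S(2) finite_subset by blast
  then obtain n where n: "f n \<in> S" using fC by blast
  have "\<Upsilon> i (n *s a i) = 0"
    using i multiple_in_cone multiple_in_ray by (simp add: Upsilon_eq_0_iff)
  then have "\<Upsilon> i (f n) = \<gamma>"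
    unfolding f_def using Q(2) QC i multiple_in_cone by (simp add: Upsilon_add)
  then obtain s where s: "s \<in> S" "\<Upsilon> i s = \<gamma>"
    and least: "\<And>s'. s' \<in> S \<Longrightarrow> \<Upsilon> i s' = \<gamma> \<Longrightarrow> coord_sum s \<le> coord_sum s'"
    using ex_has_least_nat[of "\<lambda>s. s \<in> S \<and> \<Upsilon> i s = \<gamma>" "f n" coord_sum] n by blast
  have "s \<noteq> 0"
  proof
    assume "s = 0"
    then have "\<gamma> = 0" using s S(1) i multiple_in_ray[OF i, of 0] by (auto simp: Upsilon_eq_0_iff)
    then show False using irreduciblesD(2)[OF \<gamma>] by simp
  qed
  have "s \<in> irreducibles S"
  proof (rule ccontr)
    assume "s \<notin> irreducibles S"
    then obtain y z where yz: "y \<in> S" "z \<in> S" "s = y + z" "y \<noteq> 0" "z \<noteq> 0"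
      using reducibleE[OF s(1) \<open>s \<noteq> 0\<close>] by blast
    have yzC: "y \<in> \<C>" "z \<in> \<C>" using yz S(1) by auto
    have sum: "\<gamma> = \<Upsilon> i y + \<Upsilon> i z"
      using s(2) yz(3) yzC i by (simp add: Upsilon_add)
    then have "\<Upsilon> i y = 0 \<or> \<Upsilon> i z = 0"
      using irreduciblesD(3)[OF \<gamma>] Upsilon_in_T[OF i] yzC by blast
    then have "\<Upsilon> i z = \<gamma> \<or> \<Upsilon> i y = \<gamma>" using sum by auto
    then have "coord_sum s \<le> coord_sum z \<or> coord_sum s \<le> coord_sum y"
      using least yz by blast
    then show False
      using graded_by_summands_less[OF graded_by_coord_sum, of y UNIV z] yz by auto
  qed
  then show ?thesis using that s(2) by blast
qed

text \<open>
  The generators of \<open>S\<close> on which \<open>\<Upsilon> i\<close> vanishes account for \<open>S_ray S (\<tau> i)\<close>, those with a minimal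
  generator as value account for \<open>T i\<close>; the two families are disjoint because \<open>0\<close> is not a minimal
  generator.
\<close>

lemma emb_dims_le_card_generators:
  assumes S: "add_submonoid S" "S \<subseteq> \<C>" "finite (\<C> - S)" "finite (irreducibles S)" and i: "i \<in> {1..q}"
  shows "emb_dim (S_ray S (\<tau> i)) + emb_dim (T i) \<le> card {s \<in> irreducibles S. i \<in> M_set t c q \<tau> s}"
proof -
  let ?Z = "{s \<in> irreducibles S. \<Upsilon> i s = 0}"
  let ?W = "{s \<in> irreducibles S. \<Upsilon> i s \<in> irreducibles (T i)}"
  have fin: "finite ?Z" "finite ?W" using S(4) by auto
  have "emb_dim (S_ray S (\<tau> i)) \<le> card ?Z"
    unfolding emb_dim_def min_gens_S_ray[OF S(1)]
  proof (rule card_inj_on_le[where f = "\<lambda>n. n *s a i"])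
    show "inj_on (\<lambda>n. n *s a i) (irreducibles (S_ray S (\<tau> i)))"
      using gen_nonzero[OF i] by (auto simp: inj_on_def vec_eq_iff)
    show "(\<lambda>n. n *s a i) ` irreducibles (S_ray S (\<tau> i)) \<subseteq> ?Z"
      using multiple_irreducible[OF S(2) i] i multiple_in_cone multiple_in_ray
      by (auto simp: Upsilon_eq_0_iff)
  qed (rule fin)
  moreover have "emb_dim (T i) \<le> card ?W"
    unfolding emb_dim_def min_gens_T
  proof (rule surj_card_le[OF fin(2), of _ "\<Upsilon> i"])
    show "irreducibles (T i) \<subseteq> \<Upsilon> i ` ?W"
      using irreducible_over_T_generator[OF S(2,3) i] by blast
  qed
  moreover have "card ?Z + card ?W = card (?Z \<union> ?W)"
    using fin irreduciblesD(2) by (intro card_Un_disjoint[symmetric]) fastforce+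
  moreover have "?Z \<union> ?W = {s \<in> irreducibles S. i \<in> M_set t c q \<tau> s}"
    using i by (auto simp: M_set_def min_gens_T)
  ultimately show ?thesis by simp
qed

end

section \<open>The lower bound on the embedding dimension\<close>

theorem proposition13:
  fixes L :: "(real ^ 'p::finite) set"
    and S :: "(nat ^ 'p) set"
    and c :: "nat \<Rightarrow> int ^ 'p"
    and \<tau> :: "nat \<Rightarrow> (real ^ 'p) set"
    and t q k :: nat
    and \<Lambda>' :: "(nat ^ 'p) set"
    and s :: "nat \<Rightarrow> nat ^ 'p"
  assumes "rational_polyhedral_cone L"
    and "supported_hyperplanes L t c"
    and "bij_betw \<tau> {1..q} {R. R edge_of L}"
    and "\<forall>i\<in>{1..q}. ray_determined t c (\<tau> i)"
    and "C_semigroup (int_cone L) S"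
    and "\<Lambda>' = min_gens S \<inter> ray_zonotope q \<tau>"
    and "bij_betw s {1..k} \<Lambda>'"
  shows "int (emb_dim S) \<ge>
      (\<Sum>i\<in>{1..q}. int (emb_dim (S_ray S (\<tau> i))) + int (emb_dim (T_monoid t c q \<tau> i)))
        + int k - (\<Sum>l\<in>{1..k}. int (card (M_set t c q \<tau> (s l))))"
proof -
  interpret extremal_rays L c \<tau> t q
    using assms(1-4) by unfold_locales
  let ?M = "M_set t c q \<tau>"
  obtain G where G: "finite G" "add_submonoid hull G = S"
    and S: "S \<subseteq> int_cone L" "finite (int_cone L - S)"
    using assms(5) by (auto simp: C_semigroup_def affine_semigroup_def)
  define \<Lambda> where "\<Lambda> = irreducibles S"
  have sub: "add_submonoid S" using G(2) add_submonoid_hull by blast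
  have min: "min_gens S = \<Lambda>"
    unfolding \<Lambda>_def using min_gens_eq_irreducibles[OF sub graded_by_coord_sum] .
  have fin: "finite \<Lambda>"
    unfolding \<Lambda>_def using G irreducibles_hull_subset finite_subset by blast
  have \<Lambda>': "\<Lambda>' \<subseteq> \<Lambda>" using assms(6) min by blast
  have k: "card \<Lambda>' = k" using bij_betw_same_card[OF assms(7)] by simp
  \<comment> \<open>The incidences of rays and generators are counted first ray by ray, then generator by generator.\<close>
  have "(\<Sum>i\<in>{1..q}. emb_dim (S_ray S (\<tau> i)) + emb_dim (T i)) \<le> (\<Sum>i\<in>{1..q}. card {s \<in> \<Lambda>. i \<in> ?M s})"
    unfolding \<Lambda>_def using fin by (intro sum_mono emb_dims_le_card_generators sub S) (simp_all add: \<Lambda>_def)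
  also have "\<dots> = (\<Sum>s\<in>\<Lambda>. card {i \<in> {1..q}. i \<in> ?M s})"
    using sum.swap_restrict[of "{1..q}" \<Lambda> "\<lambda>_ _. 1::nat" "\<lambda>i s. i \<in> ?M s"] fin by simp
  also have "\<dots> = (\<Sum>s\<in>\<Lambda>. card (?M s))"
    by (intro sum.cong refl arg_cong[of _ _ card]) (auto simp: M_set_def)
  also have "\<dots> = (\<Sum>s\<in>\<Lambda> - \<Lambda>'. card (?M s)) + (\<Sum>s\<in>\<Lambda>'. card (?M s))"
    by (rule sum.subset_diff[OF \<Lambda>' fin])
  also have "(\<Sum>s\<in>\<Lambda> - \<Lambda>'. card (?M s)) \<le> (\<Sum>s\<in>\<Lambda> - \<Lambda>'. 1)"
  proof (rule sum_mono)
    fix x assume "x \<in> \<Lambda> - \<Lambda>'"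
    then have "x \<in> int_cone L" "x \<notin> ray_zonotope q \<tau>"
      using assms(6) min S(1) irreduciblesD(1) by (auto simp: \<Lambda>_def)
    then show "card (?M x) \<le> 1" by (rule card_M_set_outside_zonotope)
  qed
  also have "(\<Sum>s\<in>\<Lambda> - \<Lambda>'. 1) = card \<Lambda> - k"
    using card_Diff_subset[OF finite_subset[OF \<Lambda>' fin] \<Lambda>'] k by simp
  also have "(\<Sum>s\<in>\<Lambda>'. card (?M s)) = (\<Sum>l\<in>{1..k}. card (?M (s l)))"
    by (rule sum.reindex_bij_betw[OF assms(7), symmetric])
  finally have "(\<Sum>i\<in>{1..q}. emb_dim (S_ray S (\<tau> i)) + emb_dim (T i)) \<le>
      card \<Lambda> - k + (\<Sum>l\<in>{1..k}. card (?M (s l)))" by simp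
  then have "int (\<Sum>i\<in>{1..q}. emb_dim (S_ray S (\<tau> i)) + emb_dim (T i)) \<le>
      int (card \<Lambda> - k + (\<Sum>l\<in>{1..k}. card (?M (s l))))"
    by (simp only: of_nat_le_iff)
  moreover have "k \<le> card \<Lambda>" using card_mono[OF fin \<Lambda>'] k by simp
  ultimately show ?thesis
    unfolding emb_dim_def[of S] min by (simp add: of_nat_diff)
qed

end
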